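(* Let $G$ be a finite abelian group, and let $k\geq 1$, $r\geq 2$ be integers. Let $\Omega(s_{k\exp(G)}(G))$ denote the least positive integer $n$ such that $\binom{n-1}{r-1}\geq s_{k\exp(G)}(G)$. Then $$\Omega(s_{k\exp(G)}(G))-1\leq R(\mathcal{I}_{k\exp(G)}^{(r)},G)\leq R(\mathcal{S}_{k\exp(G)}^{(r)},G)\leq \Omega(s_{k\exp(G)}(G)).$$ In particular, if $r$ divides $\Omega(s_{k\exp(G)}(G))-1$, then $R(\mathcal{I}_{k\exp(G)}^{(r)},G)=R(\mathcal{S}_{k\exp(G)}^{(r)},G)=\Omega(s_{k\exp(G)}(G))$.
   Context: $\exp(G)$ is the exponent of $G$. For a positive integer $m$ with $\exp(G)\mid m$, $s_m(G)$ is the smallest positive integer $d$ such that every sequence of $d$ elements of $G$ contains a subsequence of length $m$ whose sum is $0$ in $G$. $K_d^{(r)}$ denotes the complete $r$-uniform hypergraph on $d$ vertices (its edges are all $r$-element subsets of a $d$-element vertex set). A $G$-coloring of $K_d^{(r)}$ is any map $c$ from its edge set to $G$. An intersecting family is a set of edges any two of which have nonempty intersection; a hyperstar is a set of edges whose total intersection is nonempty. $\mathcal{I}_m^{(r)}$ (resp. $\mathcal{S}_m^{(r)}$) is the collection of all $r$-uniform intersecting families (resp. hyperstars) with $m$ edges. For such a collection $\mathcal{F}$, $R(\mathcal{F},G)$ is the smallest positive integer $d$ such that for every $G$-coloring $c$ of $K_d^{(r)}$ there is a set $E'$ of edges of $K_d^{(r)}$ forming a copy of some member of $\mathcal{F}$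 with $\sum_{e\in E'}c(e)=0$. *)

theory Defs
  imports "HOL-Algebra.Multiplicative_Group"
begin

text \<open>Abelian groups are written multiplicatively, as in \<^locale>\<open>comm_group\<close>: a sum in the group
  is a \<^const>\<open>finprod\<close>, and ``zero-sum'' means that this product is the neutral element.\<close>

definition group_exponent :: "('a, 'b) monoid_scheme \<Rightarrow> nat" where
  "group_exponent G = (LEAST n. n > 0 \<and> (\<forall>x\<in>carrier G. x [^]\<^bsub>G\<^esub> n = \<one>\<^bsub>G\<^esub>))"

text \<open>Subsequences are given by index sets, so repeated values count with multiplicity.\<close>

definition forces_zero_sum_subseq :: "('a, 'b) monoid_scheme \<Rightarrow> nat \<Rightarrow> nat \<Rightarrow> bool" where
  "forces_zero_sum_subseq G m d \<longleftrightarrow>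
    (\<forall>a \<in> {..<d} \<rightarrow> carrier G. \<exists>I \<subseteq> {..<d}. card I = m \<and> finprod G a I = \<one>\<^bsub>G\<^esub>)"

definition zero_sum_const :: "nat \<Rightarrow> ('a, 'b) monoid_scheme \<Rightarrow> nat" where
  "zero_sum_const m G = (LEAST d. d > 0 \<and> forces_zero_sum_subseq G m d)"

definition complete_hypergraph :: "nat \<Rightarrow> nat \<Rightarrow> nat set set" where
  "complete_hypergraph r d = {e. e \<subseteq> {..<d} \<and> card e = r}"

text \<open>Hypergraphs are identified with their edge sets. Since only finite hypergraphs up to
  isomorphism matter, natural numbers suffice as vertices.\<close>

definition intersecting_families :: "nat \<Rightarrow> nat \<Rightarrow> nat set set set" where
  "intersecting_families r m =
    {F. finite F \<and> card F = m \<and> (\<forall>e\<in>F. card e = r) \<and> (\<forall>e\<in>F. \<forall>f\<in>F. e \<inter> f \<noteq> {})}"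

definition hyperstars :: "nat \<Rightarrow> nat \<Rightarrow> nat set set set" where
  "hyperstars r m = {F. finite F \<and> card F = m \<and> (\<forall>e\<in>F. card e = r) \<and> \<Inter>F \<noteq> {}}"

definition is_copy_of :: "nat set set \<Rightarrow> nat set set \<Rightarrow> bool" where
  "is_copy_of E F \<longleftrightarrow> (\<exists>\<phi>. inj_on \<phi> (\<Union>F) \<and> E = (\<lambda>e. \<phi> ` e) ` F)"

definition forces_zero_sum_copy ::
    "nat \<Rightarrow> nat set set set \<Rightarrow> ('a, 'b) monoid_scheme \<Rightarrow> nat \<Rightarrow> bool" where
  "forces_zero_sum_copy r \<F> G d \<longleftrightarrow>
    (\<forall>c \<in> complete_hypergraph r d \<rightarrow> carrier G.
      \<exists>E \<subseteq> complete_hypergraph r d.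
        (\<exists>F\<in>\<F>. is_copy_of E F) \<and> finprod G c E = \<one>\<^bsub>G\<^esub>)"

definition zero_sum_ramsey ::
    "nat \<Rightarrow> nat set set set \<Rightarrow> ('a, 'b) monoid_scheme \<Rightarrow> nat" where
  "zero_sum_ramsey r \<F> G = (LEAST d. d > 0 \<and> forces_zero_sum_copy r \<F> G d)"

definition Omega :: "nat \<Rightarrow> nat \<Rightarrow> nat" where
  "Omega r s = (LEAST n. n > 0 \<and> (n - 1) choose (r - 1) \<ge> s)"

text \<open>The minima above are attained in the situations of interest, so none of the \<open>LEAST\<close>
  terms is a junk value there.\<close>

lemma group_exponent_works:
  fixes G (structure)
  assumes "comm_group G" "finite (carrier G)"
  shows "group_exponent G > 0 \<and> (\<forall>x\<in>carrier G. x [^] group_exponent G = \<one>)"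
proof -
  interpret comm_group G by fact
  have "order G > 0" using assms(2) order_gt_0_iff_finite by blast
  moreover have "\<forall>x\<in>carrier G. x [^] order G = \<one>"
    using pow_order_eq_1 by blast
  ultimately show ?thesis
    unfolding group_exponent_def
    by (intro LeastI[of "\<lambda>n. n > 0 \<and> (\<forall>x\<in>carrier G. x [^] n = \<one>)" "order G"]) auto
qed

lemma zero_sum_const_works:
  fixes G (structure)
  assumes "comm_group G" "finite (carrier G)" "m = k * group_exponent G"
  shows "zero_sum_const m G > 0 \<and> forces_zero_sum_subseq G m (zero_sum_const m G)"
proof -
  interpret comm_group G by fact
  define d where "d = Suc (m * card (carrier G))"
  have pow: "x [^] m = \<one>" if "x \<in> carrier G" for x
  proof -
    have "x [^] m = (x [^] group_exponent G) [^] k"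
      using nat_pow_pow[OF that, of "group_exponent G" k] by (simp add: assms(3) mult.commute)
    then show ?thesis using group_exponent_works[OF assms(1,2)] that by simp
  qed
  have "\<exists>I \<subseteq> {..<d}. card I = m \<and> finprod G a I = \<one>" if a: "a \<in> {..<d} \<rightarrow> carrier G" for a
  proof -
    have "\<exists>x\<in>carrier G. m \<le> card {i\<in>{..<d}. a i = x}"
    proof (rule ccontr)
      assume "\<not> ?thesis"
      then have le: "\<And>x. x \<in> carrier G \<Longrightarrow> card {i\<in>{..<d}. a i = x} \<le> m" by force
      have "{..<d} = (\<Union>x\<in>carrier G. {i\<in>{..<d}. a i = x})" using a by auto
      then have "d \<le> (\<Sum>x\<in>carrier G. card {i\<in>{..<d}. a i = x})"
        using card_UN_le[OF assms(2), of "\<lambda>x. {i\<in>{..<d}. a i = x}"] by (metis card_lessThan)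
      also have "\<dots> \<le> of_nat (card (carrier G)) * m"
        by (rule sum_bounded_above) (rule le)
      finally show False by (simp add: d_def mult.commute)
    qed
    then obtain x where x: "x \<in> carrier G" "m \<le> card {i\<in>{..<d}. a i = x}" by blast
    obtain I where I: "I \<subseteq> {i\<in>{..<d}. a i = x}" "card I = m"
      using obtain_subset_with_card_n[OF x(2)] by metis
    have "finprod G a I = finprod G (\<lambda>_. x) I"
      by (rule finprod_cong') (use I x in auto)
    also have "\<dots> = \<one>" using finprod_const[OF x(1), of I] pow[OF x(1)] I(2) by simp
    finally show ?thesis using I by auto
  qed
  then have "d > 0 \<and> forces_zero_sum_subseq G m d"
    by (auto simp: forces_zero_sum_subseq_def d_def)
  then show ?thesis unfolding zero_sum_const_def by (rule LeastI)
qed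

lemma Omega_works:
  assumes "r \<ge> 2"
  shows "Omega r s > 0 \<and> (Omega r s - 1) choose (r - 1) \<ge> s"
proof -
  obtain q where q: "r - 1 = Suc q" using assms by (cases "r - 1") auto
  have "s \<le> (s + q) choose Suc q"
  proof (induction s)
    case (Suc s)
    have "Suc s + q choose Suc q = (s + q choose q) + (s + q choose Suc q)" by simp
    moreover have "s + q choose q > 0" by simp
    ultimately show ?case using Suc.IH by linarith
  qed simp
  then have "Suc (s + q) > 0 \<and> (Suc (s + q) - 1) choose (r - 1) \<ge> s"
    using q by simp
  then show ?thesis unfolding Omega_def by (rule LeastI)
qed

lemma forces_zero_sum_hyperstar:
  fixes G (structure)
  assumes "comm_group G" "finite (carrier G)" "m = k * group_exponent G" "r \<ge> 2"
  shows "forces_zero_sum_copy r (hyperstars r m) G (Omega r (zero_sum_const m G))"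
  unfolding forces_zero_sum_copy_def
proof
  interpret comm_group G by fact
  define s where "s = zero_sum_const m G"
  define d where "d = Omega r (zero_sum_const m G)"
  fix c assume c: "c \<in> complete_hypergraph r (Omega r (zero_sum_const m G)) \<rightarrow> carrier G"
  define L where "L = {f. f \<subseteq> {1..<d} \<and> card f = r - 1}"
  have d: "d > 0" "s \<le> (d - 1) choose (r - 1)"
    using Omega_works[OF assms(4)] by (auto simp: d_def s_def)
  have "card L = (d - 1) choose (r - 1)"
    using n_subsets[of "{1..<d}" "r - 1"] by (simp add: L_def)
  with d(2) have "s \<le> card L" by simp
  then obtain L' where L': "L' \<subseteq> L" "card L' = s" "finite L'"
    by (rule obtain_subset_with_card_n)
  then obtain g where g: "bij_betw g {..<s} L'"
    using ex_bij_betw_nat_finite[OF L'(3)] by (auto simp: atLeast0LessThan)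
  define h where "h i = insert 0 (g i)" for i
  have gL: "g i \<in> L" if "i < s" for i
    using g L'(1) that by (auto simp: bij_betw_def)
  have inj: "inj_on h {..<s}"
  proof (rule inj_onI)
    fix i j assume ij: "i \<in> {..<s}" "j \<in> {..<s}" "h i = h j"
    have "0 \<notin> g i" "0 \<notin> g j" using gL[of i] gL[of j] ij by (auto simp: L_def)
    then have "g i = g j" using ij(3) by (simp add: h_def insert_ident)
    then show "i = j" using g ij by (auto simp: bij_betw_def inj_on_def)
  qed
  have hK: "h i \<in> complete_hypergraph r d" if "i < s" for i
  proof -
    have "g i \<subseteq> {1..<d}" "card (g i) = r - 1" using gL[OF that] by (auto simp: L_def)
    moreover from this have "finite (g i)" "0 \<notin> g i"
      by (auto intro: finite_subset)
    ultimately show ?thesis using d(1) assms(4)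
      by (auto simp: h_def complete_hypergraph_def)
  qed
  have cc: "c \<in> complete_hypergraph r d \<rightarrow> carrier G" using c by (simp add: d_def)
  have "(\<lambda>i. c (h i)) \<in> {..<s} \<rightarrow> carrier G" using cc hK by auto
  then obtain I where I: "I \<subseteq> {..<s}" "card I = m" "finprod G (\<lambda>i. c (h i)) I = \<one>"
    using zero_sum_const_works[OF assms(1-3)]
    unfolding forces_zero_sum_subseq_def s_def[symmetric] by blast
  have injI: "inj_on h I" using inj I(1) by (rule inj_on_subset)
  have sub: "h ` I \<subseteq> complete_hypergraph r d" using hK I(1) by auto
  have "finprod G c (h ` I) = \<one>"
    using finprod_reindex[of c h I] injI sub cc I(3) by auto
  moreover have "h ` I \<in> hyperstars r m"
  proof -
    have "0 \<in> \<Inter> (h ` I)" by (simp add: h_def)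
    moreover have "finite I" using I(1) finite_subset by blast
    moreover have "card (h ` I) = m" using card_image[OF injI] I(2) by simp
    ultimately show ?thesis using sub by (auto simp: hyperstars_def complete_hypergraph_def)
  qed
  moreover have "is_copy_of (h ` I) (h ` I)"
    unfolding is_copy_of_def by (rule exI[of _ id]) auto
  ultimately show "\<exists>E\<subseteq>complete_hypergraph r (Omega r (zero_sum_const m G)).
      (\<exists>F\<in>hyperstars r m. is_copy_of E F) \<and> finprod G c E = \<one>"
    using sub unfolding d_def by blast
qed

lemma zero_sum_ramsey_works:
  fixes G (structure)
  assumes "comm_group G" "finite (carrier G)" "m = k * group_exponent G" "r \<ge> 2"
    and "\<F> = intersecting_families r m \<or> \<F> = hyperstars r m"
  shows "zero_sum_ramsey r \<F> G > 0 \<and> forces_zero_sum_copy r \<F> G (zero_sum_ramsey r \<F> G)"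
proof -
  have "hyperstars r m \<subseteq> intersecting_families r m"
    by (auto simp: hyperstars_def intersecting_families_def)
  then have sub: "hyperstars r m \<subseteq> \<F>" using assms(5) by auto
  have "forces_zero_sum_copy r \<F> G (Omega r (zero_sum_const m G))"
    unfolding forces_zero_sum_copy_def
  proof
    fix c assume "c \<in> complete_hypergraph r (Omega r (zero_sum_const m G)) \<rightarrow> carrier G"
    then obtain E F where "E \<subseteq> complete_hypergraph r (Omega r (zero_sum_const m G))"
      "F \<in> hyperstars r m" "is_copy_of E F" "finprod G c E = \<one>"
      using forces_zero_sum_hyperstar[OF assms(1-4)] unfolding forces_zero_sum_copy_def by meson
    then show "\<exists>E\<subseteq>complete_hypergraph r (Omega r (zero_sum_const m G)).
        (\<exists>F\<in>\<F>. is_copy_of E F) \<and> finprod G c E = \<one>"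
      using sub by auto
  qed
  with Omega_works[OF assms(4)]
  have "Omega r (zero_sum_const m G) > 0 \<and>
      forces_zero_sum_copy r \<F> G (Omega r (zero_sum_const m G))" by blast
  then show ?thesis unfolding zero_sum_ramsey_def by (rule LeastI)
qed

end

theory Submission
  imports Defs
begin

text \<open>
  If the edges of \<open>K\<^sub>N\<close> split into \<open>M\<close> matchings and \<open>M\<close> is smaller than the zero-sum constant,
  colour the \<open>j\<close>-th matching with the \<open>j\<close>-th term of a sequence of length \<open>M\<close> without zero-sum
  subsequence of length \<open>m\<close>. An intersecting family uses each matching at most once, so none of
  size \<open>m\<close> is zero-sum. By Baranyai's theorem \<open>M\<close> matchings suffice as soon as \<open>M\<close> times
  \<open>N div r\<close> is at least the number of edges; this holds for \<open>M = N choose (r - 1)\<close> always, and for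
  \<open>M = (N - 1) choose (r - 1)\<close> if \<open>r\<close> divides \<open>N\<close>.

  Baranyai's theorem is proved as by Brouwer and Schrijver: vertices are added one at a time to
  partial matchings on \<open>{..<l}\<close>, in which every \<open>S\<close> occurs as often as it has extensions to an edge.
  Giving the new vertex to an occurrence of \<open>S\<close> with weight \<open>(r - card S) / (N - l)\<close> is a fractional
  solution with integral column sums, and Hall's theorem makes it integral.
\<close>

section \<open>Hall's theorem and regular selections\<close>

text \<open>If some proper nonempty \<open>K\<close> is tight, match \<open>K\<close> by induction
  and \<open>J - K\<close> outside the neighbours of \<open>K\<close>; Hall's condition survives
  there because \<open>L\<close> and \<open>K\<close> together have at least
  \<open>card L + card K\<close> neighbours. Otherwise every proper nonempty set has a spare
  neighbour, so one pair can be fixed arbitrarily and its target removed.\<close>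

theorem hall_marriage:
  assumes "finite J" and "\<And>j. j \<in> J \<Longrightarrow> finite (A j)"
    and "\<And>K. K \<subseteq> J \<Longrightarrow> card K \<le> card (\<Union>j\<in>K. A j)"
  shows "\<exists>h. inj_on h J \<and> (\<forall>j\<in>J. h j \<in> A j)"
  using assms
proof (induction "card J" arbitrary: J A rule: less_induct)
  case less
  note fin = less.prems(1) and finA = less.prems(2) and hall = less.prems(3)
  show ?case
  proof (cases "\<exists>K. K \<subset> J \<and> K \<noteq> {} \<and> card K = card (\<Union>j\<in>K. A j)")
    case True
    then obtain K where K: "K \<subset> J" "K \<noteq> {}" and tight: "card K = card (\<Union>j\<in>K. A j)" by blast
    have finK: "finite K" using K fin finite_subset by blast
    define U where "U = (\<Union>j\<in>K. A j)"
    have finU: "finite U" using finK finA K by (auto simp: U_def)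
    have "card K < card J" using K(1) fin psubset_card_mono by blast
    then have "\<exists>h. inj_on h K \<and> (\<forall>j\<in>K. h j \<in> A j)"
      by (rule less.hyps) (use finK finA hall K(1) in auto)
    then obtain h1 where h1: "inj_on h1 K" "\<forall>j\<in>K. h1 j \<in> A j" by blast
    have "card (J - K) < card J"
      using K fin finK by (intro psubset_card_mono) auto
    then have "\<exists>h. inj_on h (J - K) \<and> (\<forall>j\<in>J - K. h j \<in> A j - U)"
    proof (rule less.hyps)
      fix L assume L: "L \<subseteq> J - K"
      have finL: "finite L" using L fin finite_subset by blast
      have "card L + card K = card (L \<union> K)"
        using L finL finK by (subst card_Un_disjoint) auto
      also have "\<dots> \<le> card (\<Union>j\<in>L \<union> K. A j)" using hall[of "L \<union> K"] L K(1) by auto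
      also have "(\<Union>j\<in>L \<union> K. A j) = (\<Union>j\<in>L. A j - U) \<union> U" by (auto simp: U_def)
      also have "card \<dots> \<le> card (\<Union>j\<in>L. A j - U) + card U" by (rule card_Un_le)
      finally show "card L \<le> card (\<Union>j\<in>L. A j - U)" using tight by (simp add: U_def)
    qed (use fin finA in auto)
    then obtain h2 where h2: "inj_on h2 (J - K)" "\<forall>j\<in>J - K. h2 j \<in> A j - U" by blast
    define h where "h j = (if j \<in> K then h1 j else h2 j)" for j
    have "h1 j \<in> U" if "j \<in> K" for j using h1(2) that by (auto simp: U_def)
    then have "inj_on h J"
      using h1(1) h2 unfolding inj_on_def h_def by (metis DiffD2 DiffI)
    moreover have "\<forall>j\<in>J. h j \<in> A j" using h1(2) h2(2) by (auto simp: h_def)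
    ultimately show ?thesis by blast
  next
    case False
    show ?thesis
    proof (cases "J = {}")
      case False
      then obtain x where x: "x \<in> J" by blast
      have "card {x} \<le> card (A x)" using hall[of "{x}"] x by simp
      then obtain y where y: "y \<in> A x" by fastforce
      have "card (J - {x}) < card J" using x fin by (rule card_Diff1_less[rotated])
      then have "\<exists>h. inj_on h (J - {x}) \<and> (\<forall>j\<in>J - {x}. h j \<in> A j - {y})"
      proof (rule less.hyps)
        fix L assume L: "L \<subseteq> J - {x}"
        have finL: "finite L" using L fin finite_subset by blast
        show "card L \<le> card (\<Union>j\<in>L. A j - {y})"
        proof (cases "L = {}")
          case False
          have "L \<subset> J" using L x by blast
          then have "card L \<le> card (\<Union>j\<in>L. A j)" "card L \<noteq> card (\<Union>j\<in>L. A j)"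
            using hall[of L] False \<open>\<not> (\<exists>K. K \<subset> J \<and> K \<noteq> {} \<and> card K = card (\<Union>j\<in>K. A j))\<close>
            by auto
          moreover have "card (\<Union>j\<in>L. A j) - 1 \<le> card ((\<Union>j\<in>L. A j) - {y})"
            using diff_card_le_card_Diff[of "{y}" "\<Union>j\<in>L. A j"] by simp
          ultimately have "card L \<le> card ((\<Union>j\<in>L. A j) - {y})" by linarith
          also have "(\<Union>j\<in>L. A j) - {y} = (\<Union>j\<in>L. A j - {y})" by auto
          finally show ?thesis .
        qed simp
      qed (use fin finA in auto)
      then obtain h where h: "inj_on h (J - {x})" "\<forall>j\<in>J - {x}. h j \<in> A j - {y}" by blast
      have "inj_on (h(x := y)) J" using h unfolding inj_on_def by auto
      moreover have "\<forall>j\<in>J. (h(x := y)) j \<in> A j" using h(2) y by auto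
      ultimately show ?thesis by blast
    qed auto
  qed
qed

text \<open>Integrality of a transportation problem: \<open>w / D\<close> is a fractional choice
  with row sums 1 and column sums \<open>cap\<close>. Hall's condition follows by double counting,
  since the rows in \<open>K\<close> carry weight \<open>D * card K\<close>, all of it in columns
  whose total weight is \<open>D\<close> times their capacity.\<close>

lemma regular_selection:
  fixes w :: "'a \<Rightarrow> 'b \<Rightarrow> nat"
  assumes J: "finite J" and C: "finite C" and D: "D > 0"
    and row: "\<And>j. j \<in> J \<Longrightarrow> (\<Sum>x\<in>C. w j x) = D"
    and col: "\<And>x. x \<in> C \<Longrightarrow> (\<Sum>j\<in>J. w j x) = D * cap x"
  shows "\<exists>g. (\<forall>j\<in>J. g j \<in> C \<and> w j (g j) > 0) \<and> (\<forall>x\<in>C. card {j\<in>J. g j = x} = cap x)"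
proof -
  \<comment> \<open>Each column \<open>x\<close> is split into \<open>cap x\<close> separate
    targets, so an injective choice uses \<open>x\<close> at most \<open>cap x\<close>
    times.\<close>
  define A where "A j = Sigma {x\<in>C. w j x > 0} (\<lambda>x. {..<cap x})" for j
  have "\<exists>h. inj_on h J \<and> (\<forall>j\<in>J. h j \<in> A j)"
  proof (rule hall_marriage[OF J])
    show "finite (A j)" if "j \<in> J" for j using C by (simp add: A_def)
    fix K assume K: "K \<subseteq> J"
    define X where "X = {x\<in>C. \<exists>j\<in>K. w j x > 0}"
    have finX: "finite X" "X \<subseteq> C" using C by (auto simp: X_def)
    have "(\<Union>j\<in>K. A j) = Sigma X (\<lambda>x. {..<cap x})" by (auto simp: A_def X_def)
    then have card: "card (\<Union>j\<in>K. A j) = (\<Sum>x\<in>X. cap x)" using finX by simp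
    have "D * card K = (\<Sum>j\<in>K. \<Sum>x\<in>C. w j x)" using row K by (simp add: subset_eq)
    also have "\<dots> = (\<Sum>j\<in>K. \<Sum>x\<in>X. w j x)"
      by (intro sum.cong[OF refl] sum.mono_neutral_right) (use C in \<open>auto simp: X_def\<close>)
    also have "\<dots> \<le> (\<Sum>j\<in>J. \<Sum>x\<in>X. w j x)" by (rule sum_mono2) (use J K in auto)
    also have "\<dots> = (\<Sum>x\<in>X. \<Sum>j\<in>J. w j x)" by (rule sum.swap)
    also have "\<dots> = (\<Sum>x\<in>X. D * cap x)" using col finX by (intro sum.cong) auto
    also have "\<dots> = D * (\<Sum>x\<in>X. cap x)" by (simp add: sum_distrib_left)
    finally show "card K \<le> card (\<Union>j\<in>K. A j)" using D card by simp
  qed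
  then obtain h where h: "inj_on h J" "\<forall>j\<in>J. h j \<in> A j" by blast
  define g where "g = fst \<circ> h"
  have g: "g j \<in> C" "w j (g j) > 0" if "j \<in> J" for j
    using h(2) that by (auto simp: g_def A_def)
  have le: "card {j\<in>J. g j = x} \<le> cap x" for x
  proof -
    have "card {j\<in>J. g j = x} = card (h ` {j\<in>J. g j = x})"
      by (rule card_image[symmetric]) (rule inj_on_subset[OF h(1)], auto)
    also have "\<dots> \<le> card (Pair x ` {..<cap x})"
      by (rule card_mono) (use h(2) in \<open>auto simp: A_def g_def\<close>)
    also have "\<dots> = cap x" by (simp add: card_image inj_on_def)
    finally show ?thesis .
  qed
  \<comment> \<open>The capacities add up to \<open>card J\<close>, so none of the upper bounds
    \<open>le\<close> on \<open>C\<close> can be strict.\<close>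
  have "D * (\<Sum>x\<in>C. cap x) = (\<Sum>x\<in>C. \<Sum>j\<in>J. w j x)" using col by (simp add: sum_distrib_left)
  also have "\<dots> = (\<Sum>j\<in>J. \<Sum>x\<in>C. w j x)" by (rule sum.swap)
  also have "\<dots> = D * card J" using row by simp
  finally have "(\<Sum>x\<in>C. cap x) = card J" using D by simp
  also have "\<dots> = (\<Sum>x\<in>C. card {j\<in>J. g j = x})"
    using sum.group[OF J C image_subsetI[OF g(1)], where h = "\<lambda>_. 1::nat"] by simp
  finally have eq: "(\<Sum>x\<in>C. card {j\<in>J. g j = x}) = (\<Sum>x\<in>C. cap x)" ..
  have "card {j\<in>J. g j = x} = cap x" if "x \<in> C" for x
  proof (rule ccontr)
    assume "card {j\<in>J. g j = x} \<noteq> cap x"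
    then have "card {j\<in>J. g j = x} < cap x" using le[of x] by simp
    then have "(\<Sum>x\<in>C. card {j\<in>J. g j = x}) < (\<Sum>x\<in>C. cap x)"
      by (intro sum_strict_mono_ex1[OF C]) (use le that in auto)
    then show False using eq by simp
  qed
  then show ?thesis using g by blast
qed

section \<open>Baranyai's theorem for matchings\<close>

text \<open>Matching \<open>j\<close> has \<open>a j\<close> slots, and \<open>f j i\<close> is the trace on \<open>{..<l}\<close> of the edge that will
  occupy slot \<open>i\<close>. The third clause says that the remaining vertices suffice to fill all slots of \<open>j\<close>.\<close>

definition partial_matchings ::
    "nat \<Rightarrow> nat \<Rightarrow> nat \<Rightarrow> (nat \<Rightarrow> nat) \<Rightarrow> nat \<Rightarrow> (nat \<Rightarrow> nat \<Rightarrow> nat set) \<Rightarrow> bool" where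
  "partial_matchings N r M a l f \<longleftrightarrow>
    (\<forall>j<M. \<forall>i<a j. f j i \<subseteq> {..<l} \<and> card (f j i) \<le> r) \<and>
    (\<forall>j<M. \<forall>i<a j. \<forall>i'<a j. i \<noteq> i' \<longrightarrow> f j i \<inter> f j i' = {}) \<and>
    (\<forall>j<M. (\<Sum>i<a j. r - card (f j i)) \<le> N - l) \<and>
    (\<Sum>j<M. \<Sum>i<a j. r - card (f j i)) = (N - l) * ((N - 1) choose (r - 1)) \<and>
    (\<forall>S. S \<subseteq> {..<l} \<longrightarrow> card S \<le> r \<longrightarrow>
      (\<Sum>j<M. card {i. i < a j \<and> f j i = S}) = (N - l) choose (r - card S))"

text \<open>Rows are matchings, columns are the traces \<open>S\<close> that may receive the new
  vertex \<open>l\<close>. Scaling the weights by \<open>D = N - l\<close> makes them natural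
  numbers, and the capacity of \<open>S\<close> is the number of its extensions to an edge that
  contain \<open>l\<close> and otherwise use later vertices.\<close>

lemma partial_matchings_extend:
  assumes f: "partial_matchings N r M a l f" and l: "l < N"
  shows "\<exists>f'. partial_matchings N r M a (Suc l) f'"
proof -
  have sub: "f j i \<subseteq> {..<l}" "card (f j i) \<le> r" if "j < M" "i < a j" for i j
    using f that by (auto simp: partial_matchings_def)
  have disj: "f j i \<inter> f j i' = {}" if "j < M" "i < a j" "i' < a j" "i \<noteq> i'" for i i' j
    using f that unfolding partial_matchings_def by blast
  have rowle: "(\<Sum>i<a j. r - card (f j i)) \<le> N - l" if "j < M" for j
    using f that unfolding partial_matchings_def by blast
  \<comment> \<open>\<open>B\<close> is the degree of a vertex; \<open>tot\<close> counts the
    incidences of edges with vertices not yet placed.\<close>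
  define B where "B = ((N - 1) choose (r - 1))"
  have tot: "(\<Sum>j<M. \<Sum>i<a j. r - card (f j i)) = (N - l) * B"
    using f unfolding partial_matchings_def B_def by blast
  have cnt: "(\<Sum>j<M. card {i. i < a j \<and> f j i = S}) = (N - l) choose (r - card S)"
    if "S \<subseteq> {..<l}" "card S \<le> r" for S
    using f that unfolding partial_matchings_def by blast
  have fin: "finite (f j i)" "l \<notin> f j i" if "j < M" "i < a j" for i j
    using sub(1)[OF that] finite_subset by auto
  define D where "D = N - l"
  have D: "D > 0" "N - Suc l = D - 1" using l by (auto simp: D_def)
  \<comment> \<open>This keeps \<open>M - B\<close>, the number of matchings that skip
    \<open>l\<close>, from being truncated.\<close>
  have "D * B \<le> (\<Sum>j<M. D)" unfolding D_def tot[symmetric] by (rule sum_mono) (use rowle in auto)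
  then have BM: "B \<le> M" using D by simp
  define Q where "Q = {S. S \<subseteq> {..<l} \<and> card S \<le> r}"
  have finQ: "finite Q" unfolding Q_def by (rule finite_subset[of _ "Pow {..<l}"]) auto
  define C where "C = insert None (Some ` Q)"
  \<comment> \<open>Column \<open>None\<close> stands for leaving the new vertex \<open>l\<close> out of matching \<open>j\<close>; its weight is the slack
    of row \<open>j\<close>.\<close>
  define w where "w j x = (case x of None \<Rightarrow> D - (\<Sum>i<a j. r - card (f j i))
      | Some S \<Rightarrow> card {i. i < a j \<and> f j i = S} * (r - card S))" for j x
  \<comment> \<open>The test \<open>card S < r\<close> matters: for a full trace the truncated
    difference would be 0 and the binomial 1 instead of 0.\<close>
  define cap where "cap x = (case x of None \<Rightarrow> M - B
      | Some S \<Rightarrow> if card S < r then (D - 1) choose (r - card S - 1) else 0)" for x :: "nat set option"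
  have wsum: "(\<Sum>S\<in>Q. w j (Some S)) = (\<Sum>i<a j. r - card (f j i))" if "j < M" for j
  proof -
    have "(\<Sum>i<a j. r - card (f j i)) = (\<Sum>S\<in>Q. \<Sum>i\<in>{i\<in>{..<a j}. f j i = S}. r - card (f j i))"
      by (rule sum.group[symmetric]) (use finQ sub that in \<open>auto simp: Q_def\<close>)
    also have "\<dots> = (\<Sum>S\<in>Q. w j (Some S))" by (intro sum.cong) (auto simp: w_def)
    finally show ?thesis ..
  qed
  have "\<exists>g. (\<forall>j\<in>{..<M}. g j \<in> C \<and> w j (g j) > 0) \<and> (\<forall>x\<in>C. card {j\<in>{..<M}. g j = x} = cap x)"
  proof (rule regular_selection[OF _ _ D(1)])
    show "finite C" using finQ by (simp add: C_def)
    show "(\<Sum>x\<in>C. w j x) = D" if "j \<in> {..<M}" for j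
    proof -
      have "(\<Sum>x\<in>C. w j x) = w j None + (\<Sum>S\<in>Q. w j (Some S))"
        unfolding C_def using finQ by (subst sum.insert) (auto simp: sum.reindex)
      then show ?thesis using wsum[of j] rowle[of j] that by (simp add: w_def D_def)
    qed
    fix x assume x: "x \<in> C"
    show "(\<Sum>j\<in>{..<M}. w j x) = D * cap x"
    proof (cases x)
      case None
      have "(\<Sum>j<M. w j None) + D * B = (\<Sum>j<M. w j None + (\<Sum>i<a j. r - card (f j i)))"
        by (simp add: sum.distrib tot D_def)
      also have "\<dots> = (\<Sum>j<M. D)"
        proof (rule sum.cong)
        show "w j None + (\<Sum>i<a j. r - card (f j i)) = D" if "j \<in> {..<M}" for j
          unfolding w_def D_def option.case by (rule le_add_diff_inverse2) (use rowle that in simp)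
      qed simp
      finally show ?thesis using None by (simp add: cap_def diff_mult_distrib2 mult.commute)
    next
      case (Some S)
      then have S: "S \<subseteq> {..<l}" "card S \<le> r" using x by (auto simp: C_def Q_def)
      have "(\<Sum>j<M. w j x) = (D choose (r - card S)) * (r - card S)"
        using cnt[OF S] Some by (simp add: w_def sum_distrib_right[symmetric] D_def)
      \<comment> \<open>Absorption identity for binomials; for a full trace both sides
        vanish.\<close>
      then show ?thesis
        using Some S(2) D(1) times_binomial_minus1_eq[of "r - card S" D]
        by (auto simp: cap_def mult.commute)
    qed
  qed simp
  then obtain g where g: "\<And>j. j < M \<Longrightarrow> g j \<in> C" "\<And>j. j < M \<Longrightarrow> w j (g j) > 0"
    and gcap: "\<And>x. x \<in> C \<Longrightarrow> card {j\<in>{..<M}. g j = x} = cap x"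
    by auto
  \<comment> \<open>\<open>g j\<close> names only a trace, and the empty trace may fill several
    slots of one matching, so a single slot is picked to receive \<open>l\<close>.\<close>
  have "\<exists>y. (y = None \<and> g j = None) \<or>
      (\<exists>i. y = Some i \<and> i < a j \<and> g j = Some (f j i) \<and> card (f j i) < r)"
    if j: "j < M" for j
  proof (cases "g j")
    case (Some S)
    then have "card {i. i < a j \<and> f j i = S} > 0" "card S < r"
      using g(2)[OF j] by (auto simp: w_def)
    moreover then obtain i where "i < a j" "f j i = S" by (auto simp: card_gt_0_iff)
    ultimately show ?thesis using Some by auto
  qed auto
  then obtain sel where sel: "\<And>j. j < M \<Longrightarrow> (sel j = None \<and> g j = None) \<or>
      (\<exists>i. sel j = Some i \<and> i < a j \<and> g j = Some (f j i) \<and> card (f j i) < r)"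
    by metis
  define f' where "f' j i = (if sel j = Some i then insert l (f j i) else f j i)" for j i
  have card': "card (f' j i) = card (f j i) + (if sel j = Some i then 1 else 0)"
    if "j < M" "i < a j" for i j
    using fin[OF that] by (simp add: f'_def)
  have row': "(\<Sum>i<a j. r - card (f' j i)) + (if g j = None then 0 else 1)
      = (\<Sum>i<a j. r - card (f j i))" if j: "j < M" for j
    using sel[OF j]
  proof
    assume "sel j = None \<and> g j = None"
    then show ?thesis by (simp add: f'_def)
  next
    assume "\<exists>i. sel j = Some i \<and> i < a j \<and> g j = Some (f j i) \<and> card (f j i) < r"
    then obtain i where i: "sel j = Some i" "i < a j" "g j = Some (f j i)" "card (f j i) < r" by blast
    have "(\<Sum>k<a j. r - card (f j k)) = (r - card (f j i)) + (\<Sum>k\<in>{..<a j} - {i}. r - card (f j k))"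
      using i(2) by (subst sum.remove[of _ i]) auto
    moreover have "(\<Sum>k<a j. r - card (f' j k))
        = (r - card (f' j i)) + (\<Sum>k\<in>{..<a j} - {i}. r - card (f' j k))"
      using i(2) by (subst sum.remove[of _ i]) auto
    moreover have "(\<Sum>k\<in>{..<a j} - {i}. r - card (f' j k)) = (\<Sum>k\<in>{..<a j} - {i}. r - card (f j k))"
      by (rule sum.cong) (auto simp: f'_def i(1))
    moreover have "card (f' j i) = Suc (card (f j i))" using card'[OF j i(2)] i(1) by simp
    ultimately show ?thesis using i by simp
  qed
  have "partial_matchings N r M a (Suc l) f'"
    unfolding partial_matchings_def
  proof (intro conjI allI impI)
    fix j i assume ji: "j < M" "i < a j"
    show "f' j i \<subseteq> {..<Suc l}" using sub(1)[OF ji] by (auto simp: f'_def)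
    show "card (f' j i) \<le> r" using card'[OF ji] sub(2)[OF ji] sel[OF ji(1)] by auto
    fix i' assume "i' < a j" "i \<noteq> i'"
    then show "f' j i \<inter> f' j i' = {}"
      using disj[of j i i'] fin(2)[of j i] fin(2)[of j i'] ji by (auto simp: f'_def)
  next
    fix j assume j: "j < M"
    show "(\<Sum>i<a j. r - card (f' j i)) \<le> N - Suc l"
    proof (cases "g j")
      case None
      \<comment> \<open>Positive weight of \<open>None\<close> means positive slack, so a row that
        skips \<open>l\<close> still fits into one vertex less.\<close>
      then show ?thesis using row'[OF j] g(2)[OF j] D by (simp add: w_def)
    next
      case (Some S)
      then show ?thesis using row'[OF j] rowle[OF j] by simp
    qed
  next
    have "(\<Sum>j<M. if g j = None then 0 else 1::nat) + card {j\<in>{..<M}. g j = None} = M"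
    proof -
      have "card {j\<in>{..<M}. g j = None} = (\<Sum>j<M. if g j = None then 1 else 0::nat)"
        by (simp add: sum.If_cases Int_def)
      then have "(\<Sum>j<M. if g j = None then 0 else 1::nat) + card {j\<in>{..<M}. g j = None}
          = (\<Sum>j<M. (if g j = None then 0 else 1) + (if g j = None then 1 else 0::nat))"
        by (simp only: sum.distrib)
      also have "\<dots> = (\<Sum>j<M. 1)" by (rule sum.cong) auto
      finally show ?thesis by simp
    qed
    moreover have "card {j\<in>{..<M}. g j = None} = M - B" using gcap[of None] by (simp add: C_def cap_def)
    ultimately have "(\<Sum>j<M. if g j = None then 0 else 1::nat) = B" using BM by simp
    moreover have "(\<Sum>j<M. \<Sum>i<a j. r - card (f' j i)) + (\<Sum>j<M. if g j = None then 0 else 1::nat) = D * B"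
      unfolding D_def tot[symmetric] sum.distrib[symmetric] by (rule sum.cong) (use row' in auto)
    ultimately show "(\<Sum>j<M. \<Sum>i<a j. r - card (f' j i)) = (N - Suc l) * ((N - 1) choose (r - 1))"
      unfolding D(2) B_def[symmetric] by (simp add: diff_mult_distrib)
  next
    fix T assume T: "T \<subseteq> {..<Suc l}" "card T \<le> r"
    have finT: "finite T" using T(1) finite_subset by blast
    show "(\<Sum>j<M. card {i. i < a j \<and> f' j i = T}) = (N - Suc l) choose (r - card T)"
    proof (cases "l \<in> T")
      case True
      \<comment> \<open>A trace containing \<open>l\<close> arises only from \<open>S\<close> in the
        selected slot, hence at most once per matching.\<close>
      define S where "S = T - {l}"
      have S: "S \<subseteq> {..<l}" "card S < r" "card T = Suc (card S)" "T = insert l S" "l \<notin> S"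
        using T True finT card_Suc_Diff1[OF finT True] by (auto simp: S_def less_Suc_eq)
      have "card {i. i < a j \<and> f' j i = T} = (if g j = Some S then 1 else 0)" if j: "j < M" for j
      proof -
        have "{i. i < a j \<and> f' j i = T} = {i. i < a j \<and> sel j = Some i \<and> f j i = S}"
        proof (rule Collect_cong)
          fix i
          show "(i < a j \<and> f' j i = T) = (i < a j \<and> sel j = Some i \<and> f j i = S)"
            using fin(2)[OF j, of i] S(4,5) by (auto simp: f'_def insert_ident)
        qed
        also have "\<dots> = (if g j = Some S then {the (sel j)} else {})"
          using sel[OF j] by auto
        finally show ?thesis by simp
      qed
      then have "(\<Sum>j<M. card {i. i < a j \<and> f' j i = T}) = card {j\<in>{..<M}. g j = Some S}"
        by (simp add: sum.If_cases Int_def)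
      also have "\<dots> = cap (Some S)" by (rule gcap) (use S in \<open>auto simp: C_def Q_def\<close>)
      finally show ?thesis using S D by (simp add: cap_def)
    next
      case False
      then have Tl: "T \<subseteq> {..<l}" using T(1) by (auto simp: less_Suc_eq)
      have "card {i. i < a j \<and> f' j i = T} + (if g j = Some T then 1 else 0)
          = card {i. i < a j \<and> f j i = T}" if j: "j < M" for j
      proof (cases "g j = Some T")
        case True
        then obtain i where i: "sel j = Some i" "i < a j" "f j i = T" using sel[OF j] by auto
        have "{i. i < a j \<and> f j i = T} = insert i {i. i < a j \<and> f' j i = T}"
          "i \<notin> {i. i < a j \<and> f' j i = T}"
          using i False by (auto simp: f'_def split: if_splits)
        then show ?thesis using True by simp
      next
        case gT: False
        have "{i. i < a j \<and> f j i = T} = {i. i < a j \<and> f' j i = T}"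
          using gT False sel[OF j] by (auto simp: f'_def split: if_splits)
        then show ?thesis using gT by simp
      qed
      then have "(\<Sum>j<M. card {i. i < a j \<and> f' j i = T}) + (\<Sum>j<M. if g j = Some T then 1 else 0)
          = (\<Sum>j<M. card {i. i < a j \<and> f j i = T})"
        unfolding sum.distrib[symmetric] by (intro sum.cong) auto
      moreover have "(\<Sum>j<M. if g j = Some T then 1 else 0) = card {j\<in>{..<M}. g j = Some T}"
        by (simp add: sum.If_cases Int_def)
      moreover have "card {j\<in>{..<M}. g j = Some T} = cap (Some T)"
        by (rule gcap) (use Tl T in \<open>auto simp: C_def Q_def\<close>)
      ultimately have "(\<Sum>j<M. card {i. i < a j \<and> f' j i = T}) + cap (Some T) = D choose (r - card T)"
        using cnt[OF Tl T(2)] by (simp add: D_def)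
      \<comment> \<open>Pascal's rule: edges extending \<open>T\<close> avoid \<open>l\<close> or
        contain it. For \<open>card T = r\<close> it reads \<open>1 = 1 + 0\<close>.\<close>
      moreover have "D choose (r - card T) = ((D - 1) choose (r - card T)) + cap (Some T)"
        using T(2) D(1) choose_reduce_nat[of D "r - card T"] by (auto simp: cap_def)
      ultimately show ?thesis using D by simp
    qed
  qed
  then show ?thesis by blast
qed

text \<open>Supplies the sizes of the matchings, chosen greedily from the last index.\<close>

lemma bounded_summands_exist:
  fixes s q M :: nat
  assumes "s \<le> M * q"
  shows "\<exists>a. (\<forall>j<M. a j \<le> q) \<and> (\<Sum>j<M. a j) = s"
  using assms
proof (induction M arbitrary: s)
  case (Suc M)
  have "s - min s q \<le> M * q" using Suc.prems by auto
  then obtain a where a: "\<forall>j<M. a j \<le> q" "(\<Sum>j<M. a j) = s - min s q"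
    using Suc.IH by blast
  have "(\<Sum>j<M. (a(M := min s q)) j) = (\<Sum>j<M. a j)" by (rule sum.cong) auto
  then show ?case using a by (intro exI[of _ "a(M := min s q)"]) (auto simp: less_Suc_eq)
qed simp

text \<open>Start with empty slots, one per edge and at most \<open>N div r\<close> in each
  matching, and add all vertices. For \<open>l = N\<close> every edge fills exactly
  \<open>0 choose 0 = 1\<close> slot, whose matching is its colour.\<close>

theorem complete_hypergraph_matching_coloring:
  assumes r: "r \<ge> 1" and M: "N choose r \<le> M * (N div r)"
  shows "\<exists>\<chi>. (\<forall>e\<in>complete_hypergraph r N. \<chi> e < M) \<and>
    (\<forall>e\<in>complete_hypergraph r N. \<forall>e'\<in>complete_hypergraph r N.
      e \<noteq> e' \<longrightarrow> \<chi> e = \<chi> e' \<longrightarrow> e \<inter> e' = {})"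
proof -
  obtain a where a: "\<forall>j<M. a j \<le> N div r" "(\<Sum>j<M. a j) = N choose r"
    using bounded_summands_exist[OF M] by blast
  have "partial_matchings N r M a 0 (\<lambda>_ _. {})"
  proof -
    have "a j * r \<le> N" if "j < M" for j
      using a(1) that mult_le_mono1[of "a j" "N div r" r] div_times_less_eq_dividend[of N r]
      by (meson le_trans)
    moreover have "(\<Sum>j<M. a j * r) = N * ((N - 1) choose (r - 1))"
    proof (cases "N = 0")
      case False
      then show ?thesis using r times_binomial_minus1_eq[of r N] a(2)
        by (simp add: sum_distrib_left[symmetric] mult.commute[of _ r])
    qed (use a(2) r in \<open>auto simp: sum_distrib_right[symmetric]\<close>)
    ultimately show ?thesis using a(2) by (auto simp: partial_matchings_def)
  qed
  have "\<exists>f. partial_matchings N r M a l f" if "l \<le> N" for l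
    using that
  proof (induction l)
    case 0
    show ?case using \<open>partial_matchings N r M a 0 (\<lambda>_ _. {})\<close> by blast
  next
    case (Suc l)
    then show ?case using partial_matchings_extend[of N r M a l] by auto
  qed
  then obtain f where f: "partial_matchings N r M a N f" by blast
  have "\<exists>j i. j < M \<and> i < a j \<and> f j i = e" if "e \<in> complete_hypergraph r N" for e
  proof (rule ccontr)
    assume "\<not> ?thesis"
    then have "(\<Sum>j<M. card {i. i < a j \<and> f j i = e}) = 0" by auto
    moreover have "e \<subseteq> {..<N}" "card e = r" using that by (auto simp: complete_hypergraph_def)
    then have "(\<Sum>j<M. card {i. i < a j \<and> f j i = e}) = (N - N) choose (r - card e)"
      using f unfolding partial_matchings_def by blast
    ultimately show False using \<open>card e = r\<close> by simp
  qed
  then obtain \<chi> \<iota> where *: "\<And>e. e \<in> complete_hypergraph r N \<Longrightarrow>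
      \<chi> e < M \<and> \<iota> e < a (\<chi> e) \<and> f (\<chi> e) (\<iota> e) = e" by metis
  have "e \<inter> e' = {}" if e: "e \<in> complete_hypergraph r N" "e' \<in> complete_hypergraph r N"
    "e \<noteq> e'" "\<chi> e = \<chi> e'" for e e'
  proof -
    have "\<iota> e \<noteq> \<iota> e'" using *[OF e(1)] *[OF e(2)] e(3,4) by metis
    then have "f (\<chi> e) (\<iota> e) \<inter> f (\<chi> e) (\<iota> e') = {}"
      using f *[OF e(1)] *[OF e(2)] e(4) unfolding partial_matchings_def by metis
    then show ?thesis using *[OF e(1)] *[OF e(2)] e(4) by simp
  qed
  then show ?thesis using * by blast
qed

section \<open>Zero-sum Ramsey numbers\<close>

lemma is_copy_of_intersecting:
  assumes "F \<in> intersecting_families r m" "is_copy_of E F"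
  shows "card E = m" and "\<And>e e'. e \<in> E \<Longrightarrow> e' \<in> E \<Longrightarrow> e \<inter> e' \<noteq> {}"
proof -
  obtain \<phi> where \<phi>: "inj_on \<phi> (\<Union>F)" "E = (\<lambda>e. \<phi> ` e) ` F"
    using assms(2) by (auto simp: is_copy_of_def)
  have "inj_on (\<lambda>e. \<phi> ` e) F"
    using inj_on_image[OF \<phi>(1)] by blast
  then show "card E = m" using assms(1) \<phi>(2) by (simp add: card_image intersecting_families_def)
  show "e \<inter> e' \<noteq> {}" if "e \<in> E" "e' \<in> E" for e e'
    using that assms(1) \<phi>(2) unfolding intersecting_families_def by blast
qed

lemma not_forces_zero_sum_intersecting:
  fixes G (structure)
  assumes "comm_group G" and r: "r \<ge> 1" and M: "N choose r \<le> M * (N div r)"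
    and nf: "\<not> forces_zero_sum_subseq G m M"
  shows "\<not> forces_zero_sum_copy r (intersecting_families r m) G N"
proof
  interpret comm_group G by fact
  assume forces: "forces_zero_sum_copy r (intersecting_families r m) G N"
  obtain a where a: "a \<in> {..<M} \<rightarrow> carrier G"
    and az: "\<And>I. I \<subseteq> {..<M} \<Longrightarrow> card I = m \<Longrightarrow> finprod G a I \<noteq> \<one>"
    using nf unfolding forces_zero_sum_subseq_def by blast
  obtain \<chi> where \<chi>: "\<forall>e\<in>complete_hypergraph r N. \<chi> e < M"
    "\<forall>e\<in>complete_hypergraph r N. \<forall>e'\<in>complete_hypergraph r N.
      e \<noteq> e' \<longrightarrow> \<chi> e = \<chi> e' \<longrightarrow> e \<inter> e' = {}"
    using complete_hypergraph_matching_coloring[OF r M] by blast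
  have "(\<lambda>e. a (\<chi> e)) \<in> complete_hypergraph r N \<rightarrow> carrier G" using a \<chi>(1) by auto
  then obtain E F where E: "E \<subseteq> complete_hypergraph r N" "F \<in> intersecting_families r m"
    "is_copy_of E F" "finprod G (\<lambda>e. a (\<chi> e)) E = \<one>"
    using forces unfolding forces_zero_sum_copy_def by meson
  note EF = is_copy_of_intersecting[OF E(2,3)]
  \<comment> \<open>Distinct edges of \<open>E\<close> meet and so lie in different matchings; hence
    \<open>E\<close> selects \<open>m\<close> different terms of \<open>a\<close>.\<close>
  have inj: "inj_on \<chi> E"
  proof (rule inj_onI, rule ccontr)
    fix e e' assume "e \<in> E" "e' \<in> E" "\<chi> e = \<chi> e'" "e \<noteq> e'"
    then show False using EF(2)[of e e'] \<chi>(2) E(1) by (meson subsetD)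
  qed
  have sub: "\<chi> ` E \<subseteq> {..<M}" using \<chi>(1) E(1) by auto
  have "finprod G a (\<chi> ` E) = finprod G (\<lambda>e. a (\<chi> e)) E"
    by (rule finprod_reindex) (use sub a inj in auto)
  then show False using az[OF sub] E(4) card_image[OF inj] EF(1) by simp
qed

lemma not_forces_zero_sum_subseq_below:
  assumes "M < zero_sum_const m G" and "m > 0"
  shows "\<not> forces_zero_sum_subseq G m M"
proof (cases "M = 0")
  \<comment> \<open>Length 0 is outside the range of the minimum, but the empty sequence has no
    subsequence of positive length \<open>m\<close>.\<close>
  case True
  have "(\<lambda>_. \<one>\<^bsub>G\<^esub>) \<in> {..<M} \<rightarrow> carrier G" using True by simp
  then show ?thesis using True assms(2) unfolding forces_zero_sum_subseq_def by fastforce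
next
  case False
  then show ?thesis using assms(1) not_less_Least unfolding zero_sum_const_def by blast
qed

section \<open>Binomial estimates for the number of matchings\<close>

lemma binomial_below_Omega:
  assumes "Suc N < Omega r s"
  shows "N choose (r - 1) < s"
  using not_less_Least[OF assms[unfolded Omega_def]] by simp

text \<open>After multiplication by \<open>r\<close> the left side is
  \<open>(N - (r - 1)) * (N choose (r - 1))\<close>, and
  \<open>N - (r - 1) \<le> r * (N div r)\<close> because the remainder is at most
  \<open>r - 1\<close>.\<close>

lemma binomial_le_matching_capacity:
  assumes "r \<ge> 1"
  shows "N choose r \<le> (N choose (r - 1)) * (N div r)"
proof (cases "N < r")
  case False
  have "r * (N choose r) = (N - (r - 1)) * (N choose (r - 1))"
    using binomial_absorb_comp[of N "r - 1"] times_binomial_minus1_eq[of r N] assms False by simp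
  also have "N - (r - 1) \<le> r * (N div r)"
    using mult_div_mod_eq[of r N] mod_less_divisor[of r N] assms False by linarith
  finally have "r * (N choose r) \<le> r * ((N choose (r - 1)) * (N div r))"
    by (simp add: mult.assoc mult.left_commute mult.commute)
  then show ?thesis using assms by simp
qed simp

lemma binomial_eq_matching_capacity:
  assumes "r \<ge> 1" "N > 0" "r dvd N"
  shows "N choose r = ((N - 1) choose (r - 1)) * (N div r)"
proof -
  have "r * (N choose r) = r * (((N - 1) choose (r - 1)) * (N div r))"
    using times_binomial_minus1_eq[of r N] assms by (auto simp: mult.commute mult.left_commute)
  then show ?thesis using assms(1) by simp
qed

theorem theorem1p1:
  fixes G :: "('a, 'b) monoid_scheme" and k r m n :: nat
  assumes "comm_group G" and "finite (carrier G)"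
    and "k \<ge> 1" and "r \<ge> 2"
    and "m = k * group_exponent G"
    and "n = Omega r (zero_sum_const m G)"
  shows "n - 1 \<le> zero_sum_ramsey r (intersecting_families r m) G \<and>
    zero_sum_ramsey r (intersecting_families r m) G \<le> zero_sum_ramsey r (hyperstars r m) G \<and>
    zero_sum_ramsey r (hyperstars r m) G \<le> n \<and>
    (r dvd n - 1 \<longrightarrow>
      zero_sum_ramsey r (intersecting_families r m) G = n \<and>
      zero_sum_ramsey r (hyperstars r m) G = n)"
proof -
  define R where "R = zero_sum_ramsey r (intersecting_families r m) G"
  define R' where "R' = zero_sum_ramsey r (hyperstars r m) G"
  have m: "m > 0" using group_exponent_works[OF assms(1,2)] assms(3,5) by simp
  have R: "R > 0" "forces_zero_sum_copy r (intersecting_families r m) G R"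
    and R': "R' > 0" "forces_zero_sum_copy r (hyperstars r m) G R'"
    using zero_sum_ramsey_works[OF assms(1,2,5,4)] by (auto simp: R_def R'_def)
  \<comment> \<open>Both bounds reduce to exhibiting too few matchings that still cover all edges on
    \<open>R\<close> vertices.\<close>
  have no: False if "M < zero_sum_const m G" "R choose r \<le> M * (R div r)" for M
    using not_forces_zero_sum_intersecting[OF assms(1) _ that(2)]
      not_forces_zero_sum_subseq_below[OF that(1) m] R(2) assms(4) by simp
  have low: "n - 1 \<le> R"
  proof (rule ccontr)
    assume "\<not> n - 1 \<le> R"
    then have "R choose (r - 1) < zero_sum_const m G"
      using binomial_below_Omega assms(6) by simp
    then show False using no binomial_le_matching_capacity[of r R] assms(4) by simp
  qed
  have "hyperstars r m \<subseteq> intersecting_families r m"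
    by (auto simp: hyperstars_def intersecting_families_def)
  then have "forces_zero_sum_copy r (intersecting_families r m) G R'"
    using R'(2) unfolding forces_zero_sum_copy_def by (meson subsetD)
  then have mid: "R \<le> R'" unfolding R_def zero_sum_ramsey_def using R'(1) by (simp add: Least_le)
  have up: "R' \<le> n" unfolding R'_def zero_sum_ramsey_def
    using forces_zero_sum_hyperstar[OF assms(1,2,5,4)] Omega_works[OF assms(4)] assms(6)
    by (simp add: Least_le)
  \<comment> \<open>By \<open>low\<close>, \<open>mid\<close> and \<open>up\<close> only this value
    is left to exclude. Divisibility allows perfect matchings, which lowers the top of the binomial
    by one, to where minimality of \<open>n\<close> still applies.\<close>
  have "R \<noteq> n - 1" if "r dvd n - 1"
  proof
    assume eq: "R = n - 1"
    then have "(R - 1) choose (r - 1) < zero_sum_const m G"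
      using binomial_below_Omega[of "R - 1"] assms(6) R(1) by simp
    then show False
      using no[of "(R - 1) choose (r - 1)"] binomial_eq_matching_capacity[of r R] assms(4) R(1)
        that[folded eq]
      by (metis Suc_1 Suc_leD order_refl One_nat_def)
  qed
  then show ?thesis using low mid up unfolding R_def R'_def by fastforce
qed

end
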